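(* $\mathrm{SAT}(\aleph_1)$ implies the Continuum Hypothesis $2^{\aleph_0}=\aleph_1$.
   Context: All ultrafilters are nonprincipal. For a cardinal $\kappa$, $\mathrm{SAT}(\kappa)$ is the statement: there exists a nonprincipal ultrafilter $U$ over $\omega$ such that for every countable first-order language $L$ and every sequence $(\mathcal{A}_i)_{i\in\omega}$ of $L$-structures each of size $\le\kappa$, the ultraproduct $\prod_{i\in\omega}\mathcal{A}_i/U$ is saturated (i.e. $|M|$-saturated where $M$ is the ultraproduct: every type over fewer than $|M|$ parameters that is finitely satisfiable in $M$ is realized in $M$). *)

theory Defs
  imports Main "HOL-Library.FuncSet"
begin

unbundle cardinal_syntax

section \<open>First-order languages and structures\<close>

text \<open>Constant symbols are function symbols of arity 0.\<close>

record ('f, 'r) language =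
  funs :: "'f set"
  rels :: "'r set"
  fun_arity :: "'f \<Rightarrow> nat"
  rel_arity :: "'r \<Rightarrow> nat"

datatype 'f fo_term = Var nat | App 'f "'f fo_term list"

datatype ('f, 'r) formula =
    Eq "'f fo_term" "'f fo_term"
  | Rel 'r "'f fo_term list"
  | Neg "('f, 'r) formula"
  | Conj "('f, 'r) formula" "('f, 'r) formula"
  | Ex nat "('f, 'r) formula"

fun wf_term :: "('f, 'r) language \<Rightarrow> 'f fo_term \<Rightarrow> bool" where
  "wf_term L (Var x) \<longleftrightarrow> True"
| "wf_term L (App f ts) \<longleftrightarrow>
     f \<in> funs L \<and> length ts = fun_arity L f \<and> (\<forall>t\<in>set ts. wf_term L t)"

fun wf_formula :: "('f, 'r) language \<Rightarrow> ('f, 'r) formula \<Rightarrow> bool" where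
  "wf_formula L (Eq s t) \<longleftrightarrow> wf_term L s \<and> wf_term L t"
| "wf_formula L (Rel r ts) \<longleftrightarrow>
     r \<in> rels L \<and> length ts = rel_arity L r \<and> (\<forall>t\<in>set ts. wf_term L t)"
| "wf_formula L (Neg \<phi>) \<longleftrightarrow> wf_formula L \<phi>"
| "wf_formula L (Conj \<phi> \<psi>) \<longleftrightarrow> wf_formula L \<phi> \<and> wf_formula L \<psi>"
| "wf_formula L (Ex x \<phi>) \<longleftrightarrow> wf_formula L \<phi>"

fun term_vars :: "'f fo_term \<Rightarrow> nat set" where
  "term_vars (Var x) = {x}"
| "term_vars (App f ts) = (\<Union>t\<in>set ts. term_vars t)"

fun free_vars :: "('f, 'r) formula \<Rightarrow> nat set" where
  "free_vars (Eq s t) = term_vars s \<union> term_vars t"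
| "free_vars (Rel r ts) = (\<Union>t\<in>set ts. term_vars t)"
| "free_vars (Neg \<phi>) = free_vars \<phi>"
| "free_vars (Conj \<phi> \<psi>) = free_vars \<phi> \<union> free_vars \<psi>"
| "free_vars (Ex x \<phi>) = free_vars \<phi> - {x}"

record ('f, 'r, 'm) fo_struct =
  dom :: "'m set"
  fun_int :: "'f \<Rightarrow> 'm list \<Rightarrow> 'm"
  rel_int :: "'r \<Rightarrow> 'm list \<Rightarrow> bool"

text \<open>The interpretations are total on the types; only their values at symbols of the language
  and at argument tuples of the right length from the domain are ever relevant.\<close>

definition is_structure :: "('f, 'r) language \<Rightarrow> ('f, 'r, 'm) fo_struct \<Rightarrow> bool" where
  "is_structure L M \<longleftrightarrow>
     dom M \<noteq> {} \<and>
     (\<forall>f\<in>funs L. \<forall>xs. length xs = fun_arity L f \<and> set xs \<subseteq> dom M \<longrightarrow> fun_int M f xs \<in> dom M)"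

fun eval :: "('f, 'r, 'm) fo_struct \<Rightarrow> (nat \<Rightarrow> 'm) \<Rightarrow> 'f fo_term \<Rightarrow> 'm" where
  "eval M v (Var x) = v x"
| "eval M v (App f ts) = fun_int M f (map (eval M v) ts)"

fun sat :: "('f, 'r, 'm) fo_struct \<Rightarrow> (nat \<Rightarrow> 'm) \<Rightarrow> ('f, 'r) formula \<Rightarrow> bool" where
  "sat M v (Eq s t) \<longleftrightarrow> eval M v s = eval M v t"
| "sat M v (Rel r ts) \<longleftrightarrow> rel_int M r (map (eval M v) ts)"
| "sat M v (Neg \<phi>) \<longleftrightarrow> \<not> sat M v \<phi>"
| "sat M v (Conj \<phi> \<psi>) \<longleftrightarrow> sat M v \<phi> \<and> sat M v \<psi>"
| "sat M v (Ex x \<phi>) \<longleftrightarrow> (\<exists>a\<in>dom M. sat M (v(x := a)) \<phi>)"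

section \<open>Types and saturation\<close>

text \<open>The language \<open>L(A)\<close>, which has a new constant symbol \<open>Inr a\<close> for each parameter \<open>a \<in> A\<close>,
  and the corresponding expansion of a structure, in which \<open>Inr a\<close> denotes \<open>a\<close>.\<close>

definition lang_params :: "('f, 'r) language \<Rightarrow> 'm set \<Rightarrow> ('f + 'm, 'r) language" where
  "lang_params L A =
     \<lparr> funs = Inl ` funs L \<union> Inr ` A, rels = rels L,
       fun_arity = case_sum (fun_arity L) (\<lambda>_. 0), rel_arity = rel_arity L \<rparr>"

definition struct_params :: "('f, 'r, 'm) fo_struct \<Rightarrow> ('f + 'm, 'r, 'm) fo_struct" where
  "struct_params M =
     \<lparr> dom = dom M, fun_int = case_sum (fun_int M) (\<lambda>a _. a), rel_int = rel_int M \<rparr>"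

text \<open>The free variable of a type is the variable \<open>0\<close>. The values that the constant assignment
  \<open>\<lambda>_. b\<close> gives to the other variables are irrelevant.\<close>

definition one_var_formulas ::
    "('f, 'r) language \<Rightarrow> 'm set \<Rightarrow> ('f + 'm, 'r) formula set" where
  "one_var_formulas L A = {\<phi>. wf_formula (lang_params L A) \<phi> \<and> free_vars \<phi> \<subseteq> {0}}"

definition realizes ::
    "('f, 'r, 'm) fo_struct \<Rightarrow> 'm \<Rightarrow> ('f + 'm, 'r) formula set \<Rightarrow> bool" where
  "realizes M b p \<longleftrightarrow> (\<forall>\<phi>\<in>p. sat (struct_params M) (\<lambda>_. b) \<phi>)"

definition finitely_satisfiable ::
    "('f, 'r, 'm) fo_struct \<Rightarrow> ('f + 'm, 'r) formula set \<Rightarrow> bool" where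
  "finitely_satisfiable M p \<longleftrightarrow>
     (\<forall>q. q \<subseteq> p \<and> finite q \<longrightarrow> (\<exists>b\<in>dom M. realizes M b q))"

definition card_saturated ::
    "('f, 'r) language \<Rightarrow> 'k rel \<Rightarrow> ('f, 'r, 'm) fo_struct \<Rightarrow> bool" where
  "card_saturated L \<kappa> M \<longleftrightarrow>
     (\<forall>A p. A \<subseteq> dom M \<and> |A| <o \<kappa> \<and> p \<subseteq> one_var_formulas L A \<and> finitely_satisfiable M p
        \<longrightarrow> (\<exists>b\<in>dom M. realizes M b p))"

definition saturated :: "('f, 'r) language \<Rightarrow> ('f, 'r, 'm) fo_struct \<Rightarrow> bool" where
  "saturated L M \<longleftrightarrow> card_saturated L |dom M| M"

section \<open>Ultraproducts\<close>

definition nonprincipal_ultrafilter :: "'i filter \<Rightarrow> bool" where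
  "nonprincipal_ultrafilter U \<longleftrightarrow>
     U \<noteq> bot \<and>
     (\<forall>P. eventually P U \<or> eventually (\<lambda>i. \<not> P i) U) \<and>
     (\<forall>i. U \<noteq> principal {i})"

definition ultra_rel ::
    "'i filter \<Rightarrow> ('i \<Rightarrow> ('f, 'r, 'm) fo_struct) \<Rightarrow> ('i \<Rightarrow> 'm) rel" where
  "ultra_rel U \<A> =
     {(x, y). x \<in> (\<Pi> i\<in>UNIV. dom (\<A> i)) \<and> y \<in> (\<Pi> i\<in>UNIV. dom (\<A> i)) \<and>
        eventually (\<lambda>i. x i = y i) U}"

definition rep :: "('i \<Rightarrow> 'm) set \<Rightarrow> 'i \<Rightarrow> 'm" where
  "rep c = (SOME x. x \<in> c)"

definition ultraproduct ::
    "'i filter \<Rightarrow> ('i \<Rightarrow> ('f, 'r, 'm) fo_struct) \<Rightarrow> ('f, 'r, ('i \<Rightarrow> 'm) set) fo_struct" where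
  "ultraproduct U \<A> =
     \<lparr> dom = (\<Pi> i\<in>UNIV. dom (\<A> i)) // ultra_rel U \<A>,
       fun_int = (\<lambda>f cs. ultra_rel U \<A> `` {\<lambda>i. fun_int (\<A> i) f (map (\<lambda>c. rep c i) cs)}),
       rel_int = (\<lambda>r cs. eventually (\<lambda>i. rel_int (\<A> i) r (map (\<lambda>c. rep c i) cs)) U) \<rparr>"

section \<open>The principle SAT\<close>

text \<open>Quantification over all countable languages and over all structures of size at most \<open>\<kappa>\<close>
  is up to renaming of symbols and up to isomorphism: the symbols of a countable language may be
  taken to be natural numbers, and since \<open>\<kappa>\<close> is a relation on the type \<open>'k\<close>, every structure
  of size at most \<open>\<kappa>\<close> has an isomorphic copy whose domain is a subset of \<open>'k\<close>.\<close>

definition SAT :: "'k rel \<Rightarrow> bool" where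
  "SAT \<kappa> \<longleftrightarrow>
     (\<exists>U :: nat filter. nonprincipal_ultrafilter U \<and>
       (\<forall>(L :: (nat, nat) language) (\<A> :: nat \<Rightarrow> (nat, nat, 'k) fo_struct).
          (\<forall>i. is_structure L (\<A> i) \<and> |dom (\<A> i)| \<le>o \<kappa>)
            \<longrightarrow> saturated L (ultraproduct U \<A>)))"

end

theory Submission
  imports Defs "HOL-Library.Nat_Bijection"
begin

text \<open>Let \<open>M\<close> be the ultrapower of \<open>(\<omega>\<^sub>1, <)\<close>. Coding the initial segments of subsets of \<open>\<omega>\<close>
  shows that \<open>M\<close> has at least \<open>2\<^bsup>\<aleph>\<^sub>0\<^esup>\<close> elements. If CH failed, then saturation of \<open>M\<close> would realize the
  type saying that \<open>x\<close> lies above all \<open>\<aleph>\<^sub>1\<close> many diagonal elements. But a realization is represented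
  by some \<open>f : \<omega> \<rightarrow> \<omega>\<^sub>1\<close>, whose countable range is bounded in \<open>\<omega>\<^sub>1\<close> because \<open>\<omega>\<^sub>1\<close> is regular.\<close>

section \<open>Nonprincipal ultrafilters on the index set\<close>

lemma nonprincipal_ultrafilter_eventually_neq:
  assumes "nonprincipal_ultrafilter U"
  shows "eventually (\<lambda>j. j \<noteq> i) U"
proof (rule ccontr)
  assume "\<not> eventually (\<lambda>j. j \<noteq> i) U"
  then have ev: "eventually (\<lambda>j. j = i) U"
    using assms unfolding nonprincipal_ultrafilter_def by force
  \<comment> \<open>Since {i} is large, the value at i alone decides whether P is large, which makes
    \<open>U\<close> principal.\<close>
  have "eventually P U \<longleftrightarrow> P i" for P
  proof
    assume "eventually P U"
    with ev have "eventually (\<lambda>_. P i) U"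
      by eventually_elim simp
    then show "P i"
      using assms by (auto simp: nonprincipal_ultrafilter_def eventually_const)
  next
    assume "P i"
    with ev show "eventually P U"
      by (auto elim: eventually_mono)
  qed
  then have "U = principal {i}"
    by (simp add: filter_eq_iff eventually_principal)
  then show False
    using assms by (simp add: nonprincipal_ultrafilter_def)
qed

text \<open>A final segment contains a finite intersection of complements of points, and each such
  complement is large.\<close>

lemma nonprincipal_ultrafilter_le_sequentially:
  assumes "nonprincipal_ultrafilter (U :: nat filter)"
  shows "U \<le> sequentially"
proof (rule filter_leI)
  fix P :: "nat \<Rightarrow> bool"
  assume "eventually P sequentially"
  then obtain N where N: "\<And>n. n \<ge> N \<Longrightarrow> P n"
    by (auto simp: eventually_sequentially)
  have "eventually (\<lambda>j. \<forall>i\<in>{..<N}. j \<noteq> i) U"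
    using assms by (intro eventually_ball_finite ballI nonprincipal_ultrafilter_eventually_neq) auto
  then show "eventually P U"
    by (rule eventually_mono) (metis N lessThan_iff not_less)
qed

section \<open>Representatives in an ultraproduct and its size\<close>

lemma equiv_ultra_rel: "equiv (\<Pi> i\<in>UNIV. dom (\<A> i)) (ultra_rel U \<A>)"
proof (rule equivI)
  show "sym (ultra_rel U \<A>)"
    by (auto simp: sym_def ultra_rel_def elim: eventually_mono)
  show "trans (ultra_rel U \<A>)"
    unfolding trans_def ultra_rel_def by (auto elim: eventually_elim2)
qed (auto simp: refl_on_def ultra_rel_def)

text \<open>Symbols are interpreted in \<open>ultraproduct\<close> through the arbitrary choice
  \<open>rep\<close>; this lets a known representative replace the chosen one on a large
  set.\<close>

lemma rep_class_eventually_eq: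
  assumes "x \<in> (\<Pi> i\<in>UNIV. dom (\<A> i))"
  shows "eventually (\<lambda>i. rep (ultra_rel U \<A> `` {x}) i = x i) U"
proof -
  have "x \<in> ultra_rel U \<A> `` {x}"
    using equiv_class_self[OF equiv_ultra_rel assms] .
  then have "rep (ultra_rel U \<A> `` {x}) \<in> ultra_rel U \<A> `` {x}"
    unfolding rep_def by (rule someI[where P = "\<lambda>y. y \<in> _"])
  then show ?thesis
    by (auto simp: ultra_rel_def elim: eventually_mono)
qed

lemma rep_in_product:
  assumes "c \<in> dom (ultraproduct U \<A>)"
  shows "rep c \<in> (\<Pi> i\<in>UNIV. dom (\<A> i))"
proof -
  have c: "c \<in> (\<Pi> i\<in>UNIV. dom (\<A> i)) // ultra_rel U \<A>"
    using assms by (simp add: ultraproduct_def)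
  then have "rep c \<in> c"
    unfolding rep_def using in_quotient_imp_non_empty[OF equiv_ultra_rel]
    by (metis ex_in_conv someI)
  then show ?thesis
    using in_quotient_imp_subset[OF equiv_ultra_rel c] by auto
qed

text \<open>Distinct sets differ in all sufficiently long initial segments, so the sequences coding
  these segments agree at only finitely many indices and have distinct classes. Codes come from the
  common part of the domains, so that one enumeration \<open>e\<close> serves every index.\<close>

lemma card_ultraproduct_ge_continuum:
  fixes U :: "nat filter" and \<A> :: "nat \<Rightarrow> ('f, 'r, 'm) fo_struct"
  assumes U: "nonprincipal_ultrafilter U"
    and inf: "infinite (\<Inter>i. dom (\<A> i))"
  shows "|UNIV :: nat set set| \<le>o |dom (ultraproduct U \<A>)|"
proof -
  obtain e :: "nat \<Rightarrow> 'm" where e: "inj e" "range e \<subseteq> (\<Inter>i. dom (\<A> i))"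
    using inf infinite_countable_subset by blast
  \<comment> \<open>Cutting S to \<open>{..<n}\<close> makes it finite, and
    \<open>set_encode\<close> is injective on finite sets.\<close>
  define code where "code S n = e (set_encode (S \<inter> {..<n}))" for S n
  have code: "code S \<in> (\<Pi> i\<in>UNIV. dom (\<A> i))" for S
    using e(2) by (fastforce simp: code_def)
  have "inj (\<lambda>S. ultra_rel U \<A> `` {code S})"
  proof (rule injI)
    fix S T
    assume "ultra_rel U \<A> `` {code S} = ultra_rel U \<A> `` {code T}"
    then have "(code S, code T) \<in> ultra_rel U \<A>"
      using eq_equiv_class[OF _ equiv_ultra_rel code] by blast
    then have ev: "eventually (\<lambda>n. code S n = code T n) U"
      by (simp add: ultra_rel_def)
    \<comment> \<open>A single common segment longer than k settles membership of k.\<close>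
    have "k \<in> S \<longleftrightarrow> k \<in> T" for k
    proof -
      have "eventually (\<lambda>n. k < n) U"
        using nonprincipal_ultrafilter_le_sequentially[OF U] eventually_gt_at_top
        by (rule filter_leD)
      with ev have "eventually (\<lambda>n. code S n = code T n \<and> k < n) U"
        by (rule eventually_conj)
      moreover have "U \<noteq> bot"
        using U by (simp add: nonprincipal_ultrafilter_def)
      ultimately obtain n where n: "code S n = code T n" "k < n"
        using eventually_happens by blast
      then have "S \<inter> {..<n} = T \<inter> {..<n}"
        using e(1) unfolding code_def
        by (metis finite_Int finite_lessThan injD set_encode_inverse)
      with n show ?thesis
        by (metis IntD1 IntI lessThan_iff)
    qed
    then show "S = T" by blast
  qed
  moreover have "range (\<lambda>S. ultra_rel U \<A> `` {code S}) \<subseteq> dom (ultraproduct U \<A>)"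
    using code by (auto simp: ultraproduct_def intro: quotientI)
  ultimately show ?thesis
    using card_of_ordLeq by blast
qed

section \<open>Bounds for countable subsets of \<open>\<omega>\<^sub>1\<close>\<close>

lemma cardSuc_natLeq_countable_bounded:
  assumes K: "K \<subseteq> Field (cardSuc natLeq)" "|K| \<le>o natLeq"
  obtains a where "a \<in> Field (cardSuc natLeq)" "\<And>b. b \<in> K \<Longrightarrow> (b, a) \<in> cardSuc natLeq"
proof -
  let ?r = "cardSuc natLeq"
  have r: "Card_order ?r" "regularCard ?r"
    using cardSuc_Card_order[OF natLeq_Card_order]
      infinite_cardSuc_regularCard[OF _ natLeq_Card_order]
    by (simp_all add: Field_natLeq)
  have "|K| <o ?r"
    using K(2) cardSuc_ordLeq_ordLess[OF natLeq_Card_order card_of_Card_order] by blast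
  \<comment> \<open>By regularity a cofinal subset would have full cardinality.\<close>
  then have "\<not> cofinal K ?r"
    using r(2) K(1) not_ordLess_ordIso unfolding regularCard_def by blast
  \<comment> \<open>\<open>cofinal\<close> asks for strictly larger elements, so its failure still
    allows b = a; totality covers b \<noteq> a, and reflexivity covers b = a.\<close>
  then obtain a where a: "a \<in> Field ?r" "\<And>b. b \<in> K \<Longrightarrow> a \<noteq> b \<Longrightarrow> (a, b) \<notin> ?r"
    unfolding cofinal_def by blast
  have "Well_order ?r"
    using r(1) by (rule card_order_on_well_order_on)
  then have "total_on (Field ?r) ?r" "refl_on (Field ?r) ?r"
    by (auto simp: well_order_on_def linear_order_on_def partial_order_on_def preorder_on_def)
  then have "(b, a) \<in> ?r" if "b \<in> K" for b
    using that a K(1) unfolding total_on_def refl_on_def by (metis subsetD)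
  with a(1) show ?thesis
    using that by blast
qed

section \<open>The type of an element above the diagonal\<close>

definition order_lang :: "(nat, nat) language" where
  "order_lang = \<lparr>funs = {}, rels = {0}, fun_arity = (\<lambda>_. 0), rel_arity = (\<lambda>_. 2)\<rparr>"

text \<open>Cardinals are reflexive relations here; removing \<open>Id\<close> gives the strict
  order, so that an upper bound of all values of a representative contradicts the formula at that
  bound.\<close>

definition order_struct :: "'k rel \<Rightarrow> (nat, nat, 'k) fo_struct" where
  "order_struct r =
     \<lparr>dom = Field r, fun_int = (\<lambda>_ _. undefined),
      rel_int = (\<lambda>_ xs. (xs ! 0, xs ! 1) \<in> r - Id)\<rparr>"

definition diag :: "'i filter \<Rightarrow> 'k rel \<Rightarrow> 'k \<Rightarrow> ('i \<Rightarrow> 'k) set" where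
  "diag U r a = ultra_rel U (\<lambda>_. order_struct r) `` {\<lambda>_. a}"

definition above_formula :: "'m \<Rightarrow> (nat + 'm, nat) formula" where
  "above_formula c = Rel 0 [App (Inr c) [], Var 0]"

lemma diag_in_ultrapower:
  assumes "a \<in> Field r"
  shows "diag U r a \<in> dom (ultraproduct U (\<lambda>_. order_struct r))"
  using assms by (auto simp: ultraproduct_def diag_def order_struct_def intro!: quotientI)

text \<open>The theorem of Los for one atomic formula: \<open>rel_int\<close> unfolds to a statement
  about representatives, and that of the diagonal element is constant on a large set.\<close>

lemma sat_above_diag_iff:
  assumes "a \<in> Field r"
  shows "sat (struct_params (ultraproduct U (\<lambda>_. order_struct r))) (\<lambda>_. c)
           (above_formula (diag U r a)) \<longleftrightarrow> eventually (\<lambda>i. (a, rep c i) \<in> r - Id) U"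
proof -
  have ev: "eventually (\<lambda>i. rep (diag U r a) i = a) U"
    using assms rep_class_eventually_eq[of "\<lambda>_. a" "\<lambda>_. order_struct r" U]
    by (simp add: diag_def order_struct_def)
  have "eventually (\<lambda>i. (rep (diag U r a) i, rep c i) \<in> r - Id) U \<longleftrightarrow>
        eventually (\<lambda>i. (a, rep c i) \<in> r - Id) U"
    by (rule eventually_cong[OF ev]) simp
  then show ?thesis
    by (simp add: above_formula_def struct_params_def ultraproduct_def order_struct_def)
qed

text \<open>An infinite cardinal is a limit ordinal, so finitely many of its elements have a strict
  upper bound b in it; the diagonal element of b then realizes their formulas.\<close>

lemma finitely_satisfiable_above_diag:
  fixes U :: "'i filter"
  assumes r: "Card_order r" "infinite (Field r)"
  shows "finitely_satisfiable (ultraproduct U (\<lambda>_. order_struct r))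
           (above_formula ` diag U r ` Field r)"
  unfolding finitely_satisfiable_def
proof (intro allI impI)
  fix q
  assume "q \<subseteq> above_formula ` diag U r ` Field r \<and> finite q"
  then obtain F where F: "F \<subseteq> Field r" "finite F" "q = (above_formula \<circ> diag U r) ` F"
    using finite_subset_image[of q "above_formula \<circ> diag U r" "Field r"]
    unfolding image_comp by blast
  have wo: "Well_order r"
    using r(1) by (rule card_order_on_well_order_on)
  then have lin: "trans r" "antisym r" "total_on (Field r) r" "refl_on (Field r) r"
    by (auto simp: well_order_on_def linear_order_on_def partial_order_on_def preorder_on_def)
  have strict: "(x, z) \<in> r - Id" if "(x, y) \<in> r - Id" "(y, z) \<in> r" for x y z
    using that transD[OF lin(1), of x y z] antisymD[OF lin(2), of x y] by auto
  have "\<exists>b\<in>Field r. \<forall>a\<in>F. (a, b) \<in> r - Id"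
    using F(2,1)
  proof (induction F rule: finite_induct)
    case empty
    then show ?case
      using r(2) by (auto dest: infinite_imp_nonempty)
  next
    case (insert x F)
    then obtain b where b: "b \<in> Field r" "\<forall>a\<in>F. (a, b) \<in> r - Id"
      by auto
    obtain y where y: "y \<in> Field r" "(x, y) \<in> r - Id"
      using infinite_Card_order_limit[OF r] insert.prems by blast
    have "(b, y) \<in> r \<or> (y, b) \<in> r"
      using lin(3,4) b(1) y(1) unfolding total_on_def refl_on_def by metis
    \<comment> \<open>The larger of y and b is the new bound.\<close>
    then show ?case
    proof
      assume "(b, y) \<in> r"
      then have "\<forall>a\<in>insert x F. (a, y) \<in> r - Id"
        using b(2) y(2) strict by blast
      with y(1) show ?thesis ..
    next
      assume "(y, b) \<in> r"
      then have "\<forall>a\<in>insert x F. (a, b) \<in> r - Id"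
        using b(2) y(2) strict by blast
      with b(1) show ?thesis ..
    qed
  qed
  then obtain b where b: "b \<in> Field r" "\<And>a. a \<in> F \<Longrightarrow> (a, b) \<in> r - Id"
    by blast
  have ev: "eventually (\<lambda>i. rep (diag U r b) i = b) U"
    using b(1) rep_class_eventually_eq[of "\<lambda>_. b" "\<lambda>_. order_struct r" U]
    by (simp add: diag_def order_struct_def)
  have "realizes (ultraproduct U (\<lambda>_. order_struct r)) (diag U r b) q"
    unfolding realizes_def
  proof
    fix \<phi>
    assume "\<phi> \<in> q"
    then obtain a where a: "a \<in> F" "\<phi> = above_formula (diag U r a)"
      using F(3) by auto
    have "eventually (\<lambda>i. (a, rep (diag U r b) i) \<in> r - Id) U"
      using ev by eventually_elim (use b(2)[OF a(1)] in simp)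
    then show "sat (struct_params (ultraproduct U (\<lambda>_. order_struct r))) (\<lambda>_. diag U r b) \<phi>"
      using a F(1) sat_above_diag_iff[of a r U] by auto
  qed
  then show "\<exists>c\<in>dom (ultraproduct U (\<lambda>_. order_struct r)).
      realizes (ultraproduct U (\<lambda>_. order_struct r)) c q"
    using diag_in_ultrapower[OF b(1)] by (rule bexI)
qed

text \<open>The countably many values of \<open>rep c\<close> have a bound a; the formula for this a
  would put a strictly below \<open>rep c i\<close> for a large, hence nonempty, set of indices
  i.\<close>

lemma above_diag_not_realized:
  fixes U :: "nat filter"
  assumes "U \<noteq> bot" and c: "c \<in> dom (ultraproduct U (\<lambda>_. order_struct (cardSuc natLeq)))"
  shows "\<not> realizes (ultraproduct U (\<lambda>_. order_struct (cardSuc natLeq))) c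
           (above_formula ` diag U (cardSuc natLeq) ` Field (cardSuc natLeq))"
proof
  let ?r = "cardSuc natLeq"
  assume real: "realizes (ultraproduct U (\<lambda>_. order_struct ?r)) c
    (above_formula ` diag U ?r ` Field ?r)"
  have "range (rep c) \<subseteq> Field ?r"
    using rep_in_product[OF c] by (auto simp: order_struct_def)
  moreover have "|range (rep c)| \<le>o natLeq"
    using card_of_image card_of_nat by (rule ordLeq_ordIso_trans)
  ultimately obtain a where a: "a \<in> Field ?r" "\<And>i. (rep c i, a) \<in> ?r"
    using cardSuc_natLeq_countable_bounded by (metis rangeI)
  have "eventually (\<lambda>i. (a, rep c i) \<in> ?r - Id) U"
    using real a(1) sat_above_diag_iff[OF a(1), of U c] by (auto simp: realizes_def)
  then obtain i where i: "(a, rep c i) \<in> ?r - Id"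
    using \<open>U \<noteq> bot\<close> eventually_happens by blast
  have "Well_order ?r"
    by (intro card_order_on_well_order_on cardSuc_Card_order natLeq_Card_order)
  then have "antisym ?r"
    by (simp add: well_order_on_def linear_order_on_def partial_order_on_def)
  then show False
    using i a(2)[of i] unfolding antisym_def by blast
qed

section \<open>The continuum hypothesis from saturation\<close>

theorem theorem2p1:
  assumes "SAT (cardSuc natLeq)"
  shows "ctwo ^c natLeq =o cardSuc natLeq"
proof (rule ccontr)
  let ?r = "cardSuc natLeq"
  assume not_CH: "\<not> ctwo ^c natLeq =o ?r"
  have r: "Card_order ?r" "infinite (Field ?r)"
    using cardSuc_Card_order[OF natLeq_Card_order] cardSuc_finite[OF natLeq_Card_order]
    by (simp_all add: Field_natLeq)
  \<comment> \<open>\<open>cardSuc natLeq\<close> is a relation on \<open>nat set\<close>, which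
    fixes the type of the elements of the structures.\<close>
  obtain U :: "nat filter" where U: "nonprincipal_ultrafilter U"
    and sat: "\<forall>(L :: (nat, nat) language) (\<A> :: nat \<Rightarrow> (nat, nat, nat set) fo_struct).
      (\<forall>i. is_structure L (\<A> i) \<and> |dom (\<A> i)| \<le>o ?r) \<longrightarrow> saturated L (ultraproduct U \<A>)"
    using assms unfolding SAT_def by blast
  define M where "M = ultraproduct U (\<lambda>_. order_struct ?r)"
  have "is_structure order_lang (order_struct ?r)"
    using r(2) by (auto simp: is_structure_def order_lang_def order_struct_def)
  moreover have "|dom (order_struct ?r)| \<le>o ?r"
    using card_of_Field_ordIso[OF r(1)] ordIso_imp_ordLeq by (simp add: order_struct_def)
  ultimately have M: "card_saturated order_lang |dom M| M"
    using sat[rule_format, of order_lang "\<lambda>_. order_struct ?r"]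
    unfolding M_def saturated_def by simp

  \<comment> \<open>Cantor's theorem puts the continuum above \<open>natLeq\<close>, hence at or
    above its successor.\<close>
  have "?r \<le>o ctwo ^c natLeq"
    using natLeq_Card_order Card_order_cexp ordLess_ctwo_cexp[OF natLeq_Card_order]
    by (rule cardSuc_least)
  then have "?r <o ctwo ^c natLeq"
    using not_CH ordIso_symmetric ordLeq_iff_ordLess_or_ordIso by blast
  also have "ctwo ^c natLeq =o |UNIV :: nat set set|"
    using ordIso_symmetric[OF card_of_Pow_Func[of "UNIV :: nat set"]]
    by (simp add: cexp_def ctwo_def Field_natLeq Field_card_of)
  also have "|UNIV :: nat set set| \<le>o |dom M|"
    unfolding M_def using U r(2)
    by (intro card_ultraproduct_ge_continuum) (simp_all add: order_struct_def)
  finally have "?r <o |dom M|" .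
  \<comment> \<open>Saturation allows fewer than \<open>|dom M|\<close> parameters; the failure of
    CH makes room for \<open>\<aleph>\<^sub>1\<close> of them.\<close>
  moreover have "|diag U ?r ` Field ?r| \<le>o ?r"
    using card_of_image card_of_Field_ordIso[OF r(1)] by (rule ordLeq_ordIso_trans)
  ultimately have "|diag U ?r ` Field ?r| <o |dom M|"
    using ordLeq_ordLess_trans by blast
  moreover have "diag U ?r ` Field ?r \<subseteq> dom M"
    unfolding M_def by (intro image_subsetI diag_in_ultrapower)
  moreover have "above_formula ` diag U ?r ` Field ?r
      \<subseteq> one_var_formulas order_lang (diag U ?r ` Field ?r)"
    by (auto simp: one_var_formulas_def above_formula_def lang_params_def order_lang_def)
  moreover have "finitely_satisfiable M (above_formula ` diag U ?r ` Field ?r)"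
    unfolding M_def using r by (rule finitely_satisfiable_above_diag)
  ultimately have "\<exists>c\<in>dom M. realizes M c (above_formula ` diag U ?r ` Field ?r)"
    using M[unfolded card_saturated_def, rule_format] by simp
  then obtain c where "c \<in> dom M" "realizes M c (above_formula ` diag U ?r ` Field ?r)" ..
  moreover have "U \<noteq> bot"
    using U by (simp add: nonprincipal_ultrafilter_def)
  ultimately show False
    unfolding M_def using above_diag_not_realized by metis
qed

end
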